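(* Let $g,h$ be arithmetic functions with $g(1)=1$ and $0<h(n)\le h(n+1)$ for all $n\ge 1$, put $h(0):=0$, and let $P_n^{g,h}(x)$ be the associated polynomials. Let $0<\varepsilon<1$. Assume that the power series $$G_2(T)=\sum_{k=2}^{\infty}|g(k+1)-g(2)g(k)|\,T^k$$ has radius of convergence $R>0$ (possibly $R=\infty$). Let $0<T_\varepsilon<R$ be such that $G_2(T_\varepsilon)\le\varepsilon$, and put $$\kappa=\kappa_\varepsilon:=\frac{1}{1-\varepsilon}\left(\frac{1}{T_\varepsilon}+|g(2)|\right).$$ Then for all $n\ge 1$ and all $x\in\mathbb{C}$ with $|x|>\kappa\,h(n-1)$, $$\frac{|x+g(2)h(n-1)|-\varepsilon|x|}{h(n)}\left|P_{n-1}^{g,h}(x)\right|<\left|P_n^{g,h}(x)\right|<\frac{|x+g(2)h(n-1)|+\varepsilon|x|}{h(n)}\left|P_{n-1}^{g,h}(x)\right|.$$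
   Context: An arithmetic function is a function on the positive integers; $g$ is complex-valued and $h$ is real-valued. The polynomials $P_n^{g,h}(x)$ are defined by $P_0^{g,h}(x)=1$ and, for $n\ge1$, $$P_n^{g,h}(x)=\frac{x}{h(n)}\sum_{k=1}^{n}g(k)\,P_{n-k}^{g,h}(x).$$ *)

theory Defs
  imports "HOL-Analysis.Analysis" "HOL-Computational_Algebra.Computational_Algebra"
begin

text \<open>
  Arithmetic functions are modelled as functions on \<^typ>\<open>nat\<close>. The polynomials depend only on the
  values of g and h at positive integers: g is used at indices k in {1..n}, h at index n.
\<close>

fun P_poly :: "(nat \<Rightarrow> complex) \<Rightarrow> (nat \<Rightarrow> real) \<Rightarrow> nat \<Rightarrow> complex poly" where
  "P_poly g h 0 = 1"
| "P_poly g h (Suc n) =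
     smult (1 / of_real (h (Suc n)))
       ([:0, 1:] * (\<Sum>k=1..Suc n. smult (g k) (P_poly g h (Suc n - k))))"

definition G2 :: "(nat \<Rightarrow> complex) \<Rightarrow> real fps" where
  "G2 g = Abs_fps (\<lambda>k. if k \<ge> 2 then norm (g (k + 1) - g 2 * g k) else 0)"

lemma poly_P_poly_0: "poly (P_poly g h 0) x = 1"
  by simp

lemma poly_P_poly:
  assumes "n \<ge> 1"
  shows "poly (P_poly g h n) x =
    x / of_real (h n) * (\<Sum>k=1..n. g k * poly (P_poly g h (n - k)) x)"
proof -
  obtain m where "n = Suc m"
    using assms by (cases n) auto
  then show ?thesis
    by (simp add: poly_sum del: sum.cl_ivl_Suc)
qed

end

theory Submission
  imports Defs
begin

text \<open>
  Write \<open>p\<^sub>n\<close> for the value at \<open>x\<close>. Subtracting \<open>g(2)\<close> times the recurrence for \<open>h(n-1) p\<^bsub>n-1\<^esub>\<close> from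
  the one for \<open>h(n) p\<^sub>n\<close> leaves \<open>(x + g(2) h(n-1)) p\<^bsub>n-1\<^esub>\<close> plus an error with coefficients
  \<open>g(k+1) - g(2) g(k)\<close>, \<open>k \<ge> 2\<close>. If \<open>|p\<^sub>j| < T |p\<^bsub>j+1\<^esub>|\<close> for \<open>j < n-1\<close>, the error is less than
  \<open>\<epsilon> |x| |p\<^bsub>n-1\<^esub>|\<close> because \<open>G\<^sub>2(T) \<le> \<epsilon>\<close>; and the lower bound so obtained propagates
  the growth hypothesis to \<open>j = n-1\<close>, by the choice of \<open>\<kappa>\<close>.
\<close>

text \<open>The convention \<open>h 0 = 0\<close> makes both sides vanish at \<open>n = 0\<close>.
  The two-term recurrence can therefore subtract this identity at every index, and the theorem's
  case \<open>n = 1\<close> needs no separate treatment.\<close>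

lemma P_poly_recurrence:
  assumes "h 0 = 0" and "\<And>m. m \<ge> 1 \<Longrightarrow> 0 < h m"
  shows "of_real (h n) * poly (P_poly g h n) x = x * (\<Sum>k=1..n. g k * poly (P_poly g h (n - k)) x)"
proof (cases "n = 0")
  case True
  then show ?thesis using assms(1) by simp
next
  case False
  then have "h n \<noteq> 0" using assms(2)[of n] by simp
  then show ?thesis using poly_P_poly[of n g h x] False by (simp add: field_simps)
qed

lemma P_poly_two_term_recurrence:
  assumes "g 1 = 1" and "h 0 = 0" and "\<And>m. m \<ge> 1 \<Longrightarrow> 0 < h m"
  shows "of_real (h (Suc n)) * poly (P_poly g h (Suc n)) x
      - (x + g 2 * of_real (h n)) * poly (P_poly g h n) x
    = x * (\<Sum>k=2..n. (g (k + 1) - g 2 * g k) * poly (P_poly g h (n - k)) x)"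
proof -
  define p where "p m = poly (P_poly g h m) x" for m
  have rec: "of_real (h m) * p m = x * (\<Sum>k=1..m. g k * p (m - k))" for m
    unfolding p_def using assms(2,3) by (rule P_poly_recurrence)
  have "(\<Sum>k=1..Suc n. g k * p (Suc n - k)) = p n + (\<Sum>k=Suc 1..Suc n. g k * p (Suc n - k))"
    using assms(1) by (subst sum.atLeast_Suc_atMost) simp_all
  also have "(\<Sum>k=Suc 1..Suc n. g k * p (Suc n - k)) = (\<Sum>k=1..n. g (k + 1) * p (n - k))"
    by (subst sum.shift_bounds_cl_Suc_ivl) simp
  finally have Suc_n: "of_real (h (Suc n)) * p (Suc n) = x * p n + x * (\<Sum>k=1..n. g (k + 1) * p (n - k))"
    by (simp only: rec distrib_left)
  have "(\<Sum>k=1..n. g (k + 1) * p (n - k)) - g 2 * (\<Sum>k=1..n. g k * p (n - k))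
      = (\<Sum>k=1..n. (g (k + 1) - g 2 * g k) * p (n - k))"
    by (simp add: sum_distrib_left sum_subtractf algebra_simps)
  \<comment> \<open>The term \<open>k = 1\<close> is \<open>g 2 - g 2 * g 1\<close>, which is zero
    because \<open>g 1 = 1\<close>.\<close>
  also have "\<dots> = (\<Sum>k=2..n. (g (k + 1) - g 2 * g k) * p (n - k))"
    using assms(1) by (intro sum.mono_neutral_right) (auto simp: numeral_2_eq_2 not_le less_Suc_eq_le)
  finally have diff: "(\<Sum>k=1..n. g (k + 1) * p (n - k))
      = g 2 * (\<Sum>k=1..n. g k * p (n - k)) + (\<Sum>k=2..n. (g (k + 1) - g 2 * g k) * p (n - k))"
    by (simp add: algebra_simps)
  have "g 2 * of_real (h n) * p n = x * (g 2 * (\<Sum>k=1..n. g k * p (n - k)))"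
    by (simp only: mult.assoc rec mult.left_commute[of x])
  then show ?thesis
    unfolding p_def[symmetric] Suc_n diff by (simp only: distrib_left distrib_right) simp
qed

lemma norm_le_power_mult_norm:
  fixes p :: "nat \<Rightarrow> 'a::real_normed_vector"
  assumes "0 < T" and growth: "\<And>j. j < n \<Longrightarrow> norm (p j) < T * norm (p (Suc j))" and "k \<le> n"
  shows "norm (p (n - k)) \<le> T ^ k * norm (p n)"
  using \<open>k \<le> n\<close>
proof (induction k)
  case (Suc k)
  then have "norm (p (n - Suc k)) < T * norm (p (n - k))"
    using growth[of "n - Suc k"] by (simp add: Suc_diff_Suc)
  also have "\<dots> \<le> T * (T ^ k * norm (p n))"
    using Suc \<open>0 < T\<close> by (intro mult_left_mono) auto
  finally show ?case by simp
qed simp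

text \<open>The series converges inside its radius and has nonnegative terms for \<open>T\<close>
  \<ge> 0, so no partial sum exceeds its value.\<close>

lemma partial_sum_le_eval_G2:
  assumes "0 \<le> T" and "ereal T < fps_conv_radius (G2 g)"
  shows "(\<Sum>k=2..n. norm (g (k + 1) - g 2 * g k) * T ^ k) \<le> eval_fps (G2 g) T"
proof -
  have "summable (\<lambda>k. fps_nth (G2 g) k * T ^ k)"
    using assms by (intro summable_fps) auto
  then have "(\<Sum>k=2..n. fps_nth (G2 g) k * T ^ k) \<le> eval_fps (G2 g) T"
    unfolding eval_fps_def using assms by (intro sum_le_suminf) (auto simp: G2_def)
  then show ?thesis by (simp add: G2_def)
qed

text \<open>
  Equality in the partial sum bound is compatible with strictness: the terms with nonzero
  coefficient are strictly smaller, and if all coefficients vanish then \<open>0 < \<epsilon>\<close> is used.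
\<close>

lemma norm_weighted_sum_less:
  fixes p a :: "nat \<Rightarrow> 'a::real_normed_field"
  assumes "0 < T" and growth: "\<And>j. j < n \<Longrightarrow> norm (p j) < T * norm (p (Suc j))"
    and "p n \<noteq> 0" and "0 < \<epsilon>" and bound: "(\<Sum>k=2..n. norm (a k) * T ^ k) \<le> \<epsilon>"
  shows "norm (\<Sum>k=2..n. a k * p (n - k)) < \<epsilon> * norm (p n)"
proof (cases "\<exists>k\<in>{2..n}. a k \<noteq> 0")
  case False
  then show ?thesis using assms by simp
next
  case True
  then obtain k where k: "k \<in> {2..n}" "a k \<noteq> 0" by blast
  have less: "norm (p (n - i)) < T ^ i * norm (p n)" if "i \<in> {2..n}" for i
  proof -
    have i: "Suc (i - 1) = i" "Suc (n - i) = n - (i - 1)" using that by auto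
    \<comment> \<open>One growth step is kept strict; the other \<open>i - 1\<close> steps need only
      the weak bound.\<close>
    have "norm (p (n - i)) < T * norm (p (n - (i - 1)))"
      using growth[of "n - i"] that i by simp
    also have "\<dots> \<le> T * (T ^ (i - 1) * norm (p n))"
      using that \<open>0 < T\<close> by (intro mult_left_mono norm_le_power_mult_norm growth) auto
    also have "\<dots> = T ^ i * norm (p n)"
      using i(1) by (metis mult.assoc power_Suc)
    finally show ?thesis .
  qed
  have "norm (\<Sum>k=2..n. a k * p (n - k)) \<le> (\<Sum>k=2..n. norm (a k) * norm (p (n - k)))"
    by (rule order_trans[OF norm_sum]) (simp add: norm_mult)
  also have "\<dots> < (\<Sum>k=2..n. norm (a k) * (T ^ k * norm (p n)))"
  proof (rule sum_strict_mono_ex1)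
    show "\<forall>i\<in>{2..n}. norm (a i) * norm (p (n - i)) \<le> norm (a i) * (T ^ i * norm (p n))"
      using less by (auto intro!: mult_left_mono simp: less_imp_le)
    show "\<exists>i\<in>{2..n}. norm (a i) * norm (p (n - i)) < norm (a i) * (T ^ i * norm (p n))"
      using less k by (intro bexI[of _ k] mult_strict_left_mono) auto
  qed simp
  also have "\<dots> = (\<Sum>k=2..n. norm (a k) * T ^ k) * norm (p n)"
    by (simp add: sum_distrib_right mult.assoc)
  also have "\<dots> \<le> \<epsilon> * norm (p n)"
    using bound by (intro mult_right_mono) auto
  finally show ?thesis .
qed

text \<open>The triangle inequality gives the upper bound and its reverse form the lower one; both
  inherit strictness from the error estimate.\<close>

lemma norm_bounds_from_error:
  fixes p q a :: complex
  assumes "0 < c" and "norm (of_real c * q - a * p) < e * norm p"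
  shows "(norm a - e) / c * norm p < norm q" and "norm q < (norm a + e) / c * norm p"
proof -
  have "norm (of_real c * q) = c * norm q" using \<open>0 < c\<close> by (simp add: norm_mult)
  moreover have "norm (a * p) = norm a * norm p" by (rule norm_mult)
  moreover have "norm (a * p) - norm (of_real c * q) \<le> norm (of_real c * q - a * p)"
    using norm_triangle_ineq2[of "a * p" "of_real c * q"] by (simp add: norm_minus_commute)
  moreover have "norm (of_real c * q) - norm (a * p) \<le> norm (of_real c * q - a * p)"
    by (rule norm_triangle_ineq2)
  ultimately have "(norm a - e) * norm p < norm q * c" "norm q * c < (norm a + e) * norm p"
    using assms(2) by (simp_all add: algebra_simps)
  then show "(norm a - e) / c * norm p < norm q" "norm q < (norm a + e) / c * norm p"
    using \<open>0 < c\<close> by (simp_all add: pos_divide_less_eq pos_less_divide_eq)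
qed

theorem theorem4:
  fixes g :: "nat \<Rightarrow> complex" and h :: "nat \<Rightarrow> real"
    and \<epsilon> T \<kappa> :: real and R :: ereal and n :: nat and x :: complex
  assumes "g 1 = 1"
    and "\<And>m. m \<ge> 1 \<Longrightarrow> 0 < h m \<and> h m \<le> h (m + 1)"
    and "h 0 = 0"
    and "0 < \<epsilon>" and "\<epsilon> < 1"
    and "R = fps_conv_radius (G2 g)" and "R > 0"
    and "0 < T" and "ereal T < R"
    and "eval_fps (G2 g) T \<le> \<epsilon>"
    and "\<kappa> = 1 / (1 - \<epsilon>) * (1 / T + norm (g 2))"
    and "n \<ge> 1"
    and "norm x > \<kappa> * h (n - 1)"
  shows "(norm (x + g 2 * of_real (h (n - 1))) - \<epsilon> * norm x) / h n
             * norm (poly (P_poly g h (n - 1)) x)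
           < norm (poly (P_poly g h n) x)
       \<and> norm (poly (P_poly g h n) x)
           < (norm (x + g 2 * of_real (h (n - 1))) + \<epsilon> * norm x) / h n
             * norm (poly (P_poly g h (n - 1)) x)"
proof -
  define p where "p m = poly (P_poly g h m) x" for m
  have h_pos: "0 < h m" if "m \<ge> 1" for m using assms(2) that by blast
  have h_nonneg: "0 \<le> h m" for m using h_pos[of m] assms(3) by (cases "m = 0") auto
  have h_mono: "h i \<le> h j" if "i \<le> j" for i j
  proof (rule lift_Suc_mono_le[OF _ that])
    show "h m \<le> h (Suc m)" for m using assms(2)[of m] h_nonneg[of 1] assms(3) by (cases "m = 0") auto
  qed
  have \<kappa>_pos: "0 < \<kappa>" using assms(5,8,11) by (simp add: add_pos_nonneg)
  have "0 \<le> \<kappa> * h (n - 1)" using \<kappa>_pos h_nonneg by simp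
  \<comment> \<open>The error estimate is multiplied by \<open>norm x\<close>, so its strictness
    requires \<open>x\<close> to be nonzero.\<close>
  with assms(13) have x: "0 < norm x" by linarith
  have G2_bound: "(\<Sum>k=2..m. norm (g (k + 1) - g 2 * g k) * T ^ k) \<le> \<epsilon>" for m
    using partial_sum_le_eval_G2[of T g m] assms(6,8-10) by simp
  have two_term: "of_real (h (Suc m)) * p (Suc m) - (x + g 2 * of_real (h m)) * p m
      = x * (\<Sum>k=2..m. (g (k + 1) - g 2 * g k) * p (m - k))" for m
    unfolding p_def using assms(1,3) h_pos by (rule P_poly_two_term_recurrence)
  have error: "norm (of_real (h (Suc m)) * p (Suc m) - (x + g 2 * of_real (h m)) * p m)
      < \<epsilon> * norm x * norm (p m)"
    if growth: "\<And>j. j < m \<Longrightarrow> norm (p j) < T * norm (p (Suc j))" and "p m \<noteq> 0" for m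
  proof -
    have "norm (\<Sum>k=2..m. (g (k + 1) - g 2 * g k) * p (m - k)) < \<epsilon> * norm (p m)"
      using assms(8) growth \<open>p m \<noteq> 0\<close> assms(4) G2_bound by (rule norm_weighted_sum_less)
    then show ?thesis
      using x by (simp add: two_term norm_mult mult.left_commute[of \<epsilon>] mult.assoc)
  qed
  \<comment> \<open>Nonvanishing is carried along because the error estimate at \<open>m\<close>
    requires it; the strict growth inequality then yields it for \<open>Suc m\<close>. The range
    stops at \<open>n - 1\<close> because monotonicity of \<open>h\<close> bounds
    \<open>h (Suc m)\<close> by \<open>h (n - 1)\<close> only there.\<close>
  have growth: "p m \<noteq> 0 \<and> (\<forall>j<m. norm (p j) < T * norm (p (Suc j)))" if "m \<le> n - 1" for m
    using that
  proof (induction m)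
    case 0
    then show ?case by (simp add: p_def)
  next
    case (Suc m)
    then have IH: "p m \<noteq> 0" "\<And>j. j < m \<Longrightarrow> norm (p j) < T * norm (p (Suc j))" by auto
    have h: "0 < h (Suc m)" "h (Suc m) \<le> h (n - 1)" "h m \<le> h (Suc m)"
      using h_pos h_mono Suc.prems by auto
    \<comment> \<open>By definition (1 - \<epsilon>) \<kappa> is \<open>1 / T + norm (g 2)\<close>.
      The second summand pays for the loss in the reverse triangle inequality for
      \<open>x + g 2 * of_real (h m)\<close>; the first remains as the growth factor
      \<open>1 / T\<close>.\<close>
    have "(1 / T + norm (g 2)) * h (Suc m) \<le> (1 / T + norm (g 2)) * h (n - 1)"
      using h assms(8) by (intro mult_left_mono) auto
    also have "\<dots> = (1 - \<epsilon>) * (\<kappa> * h (n - 1))"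
      using assms(5,11) by simp
    also have "\<dots> < (1 - \<epsilon>) * norm x"
      using assms(5,13) by simp
    finally have "1 / T * h (Suc m) + norm (g 2) * h (Suc m) < norm x - \<epsilon> * norm x"
      by (simp add: algebra_simps)
    moreover have "norm (g 2) * h m \<le> norm (g 2) * h (Suc m)"
      using h by (intro mult_left_mono) auto
    moreover have "norm x - norm (g 2) * h m \<le> norm (x + g 2 * of_real (h m))"
      using norm_diff_ineq[of x "g 2 * of_real (h m)"] h_nonneg[of m] by (simp add: norm_mult)
    ultimately have "1 / T * h (Suc m) < norm (x + g 2 * of_real (h m)) - \<epsilon> * norm x" by linarith
    then have "1 / T \<le> (norm (x + g 2 * of_real (h m)) - \<epsilon> * norm x) / h (Suc m)"
      using h(1) by (simp add: pos_le_divide_eq)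
    then have "1 / T * norm (p m) \<le> (norm (x + g 2 * of_real (h m)) - \<epsilon> * norm x) / h (Suc m) * norm (p m)"
      by (intro mult_right_mono) auto
    also have "\<dots> < norm (p (Suc m))"
      using norm_bounds_from_error(1)[OF h(1) error[OF IH(2,1)]] .
    finally have less: "norm (p m) < T * norm (p (Suc m))"
      using assms(8) by (simp add: field_simps)
    then have "p (Suc m) \<noteq> 0" by auto
    with less IH show ?case by (auto simp: less_Suc_eq)
  qed
  have "h n > 0" using h_pos assms(12) by simp
  moreover have "norm (of_real (h n) * p n - (x + g 2 * of_real (h (n - 1))) * p (n - 1))
      < \<epsilon> * norm x * norm (p (n - 1))"
    using error[of "n - 1"] growth[of "n - 1"] assms(12) by simp
  ultimately show ?thesis
    using norm_bounds_from_error unfolding p_def by blast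
qed

end
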